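(* There exists an injective metric space $Y$ that admits a reversible conical bicombing $\sigma$ such that $Y$ has a finite subset whose closed $\sigma$-convex hull is non-compact.
   Context: A metric space $Y$ is injective if whenever $X$ is a metric space, $A\subset X$, and $f\colon A\to Y$ is $1$-Lipschitz, there exists a $1$-Lipschitz map $F\colon X\to Y$ extending $f$. A geodesic in a metric space $(Y,d)$ is a map $c\colon[0,1]\to Y$ with $d(c(s),c(t))=|s-t|\,d(c(0),c(1))$ for all $s,t\in[0,1]$. A (geodesic) bicombing on $Y$ is a map $\sigma\colon Y\times Y\times[0,1]\to Y$ such that for all $x,y\in Y$ the path $\sigma_{xy}(t)=\sigma(x,y,t)$ is a geodesic with $\sigma_{xy}(0)=x$, $\sigma_{xy}(1)=y$. It is conical if $d(\sigma_{xy}(t),\sigma_{x'y'}(t))\le(1-t)\,d(x,x')+t\,d(y,y')$ for all $x,y,x',y'\in Y$, $t\in[0,1]$, and reversible if $\sigma_{xy}(t)=\sigma_{yx}(1-t)$ for all $x,y\in Y$, $t\in[0,1]$. A subset $C\subset Y$ is $\sigma$-convex if $\sigma_{xy}([0,1])\subset C$ for all $x,y\in C$. The closed $\sigma$-convex hull of $A\subset Y$ is the intersection of all closed $\sigma$-convex subsets of $Y$ containing $A$. *)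

theory Defs
  imports "HOL-Analysis.Analysis"
begin

text \<open>
  Metric spaces are values of the library type \<open>'a metric\<close>: a carrier \<open>mspace Y\<close>, possibly a
  proper subset of the type, and a distance \<open>mdist Y\<close>.  Maps into or out of \<open>Y\<close> are total
  functions that are only constrained on the carrier.
\<close>

definition one_lipschitz_map :: "'x metric \<Rightarrow> 'y metric \<Rightarrow> ('x \<Rightarrow> 'y) \<Rightarrow> bool" where
  "one_lipschitz_map X Y f \<longleftrightarrow>
     f \<in> mspace X \<rightarrow> mspace Y \<and>
     (\<forall>x\<in>mspace X. \<forall>x'\<in>mspace X. mdist Y (f x) (f x') \<le> mdist X x x')"


section \<open>Injective metric spaces\<close>

text \<open>
  The definition of injectivity quantifies over all metric spaces \<open>X\<close>.  A HOL formula cannot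
  quantify over types, so we first let \<open>X\<close> range over the metric spaces carried by subsets of
  one given type \<open>'x\<close>.
\<close>

definition injective_wrt :: "'x itself \<Rightarrow> 'y metric \<Rightarrow> bool" where
  "injective_wrt (_ :: 'x itself) Y \<longleftrightarrow>
     (\<forall>(X :: 'x metric) A f.
        A \<subseteq> mspace X \<and> one_lipschitz_map (submetric X A) Y f \<longrightarrow>
        (\<exists>F. one_lipschitz_map X Y F \<and> (\<forall>a\<in>A. F a = f a)))"

text \<open>
  The type \<open>'y option\<close> is large enough to test against: by the theorem
  \<open>injective_metric_space_imp_injective_wrt\<close> below, the extension property then holds for
  metric spaces \<open>X\<close> over every type, so no generality is lost.
\<close>

definition injective_metric_space :: "'y metric \<Rightarrow> bool" where
  "injective_metric_space (Y :: 'y metric) \<longleftrightarrow> injective_wrt TYPE('y option) Y"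

lemma injective_metric_space_nonempty:
  fixes Y :: "'y metric"
  assumes "injective_metric_space Y"
  shows "mspace Y \<noteq> {}"
proof -
  define X :: "'y option metric" where "X = metric ({None}, \<lambda>_ _. 0)"
  have "Metric_space {None :: 'y option} (\<lambda>_ _. 0)"
    by unfold_locales auto
  then have sp: "mspace X = {None}" unfolding X_def by (rule Metric_space.mspace_metric)
  have "{} \<subseteq> mspace X \<and> one_lipschitz_map (submetric X {}) Y (\<lambda>_. undefined)"
    by (simp add: one_lipschitz_map_def)
  from assms[unfolded injective_metric_space_def injective_wrt_def, rule_format, OF this]
  obtain F where "one_lipschitz_map X Y F" by (elim exE conjE)
  then have "F None \<in> mspace Y" by (auto simp: one_lipschitz_map_def sp)
  then show ?thesis by auto
qed

lemma injective_metric_space_point: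
  fixes Y :: "'y metric" and r :: "'y \<Rightarrow> real"
  assumes inj: "injective_metric_space Y"
    and lip: "\<And>y z. y \<in> mspace Y \<Longrightarrow> z \<in> mspace Y \<Longrightarrow> r y \<le> r z + mdist Y y z"
    and tri: "\<And>y z. y \<in> mspace Y \<Longrightarrow> z \<in> mspace Y \<Longrightarrow> mdist Y y z \<le> r y + r z"
  shows "\<exists>p\<in>mspace Y. \<forall>y\<in>mspace Y. mdist Y y p \<le> r y"
proof (cases "\<exists>y0\<in>mspace Y. r y0 = 0")
  case True
  then obtain y0 where "y0 \<in> mspace Y" "r y0 = 0" by auto
  then show ?thesis using tri by force
next
  case False
  have nn: "0 \<le> r y" if "y \<in> mspace Y" for y
    using tri[OF that that] mdist_nonneg[of Y y y] by linarith
  define e where "e u v = (case u of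
      None \<Rightarrow> (case v of None \<Rightarrow> 0 | Some z \<Rightarrow> \<bar>r z\<bar>)
    | Some y \<Rightarrow> (case v of None \<Rightarrow> \<bar>r y\<bar> | Some z \<Rightarrow> mdist Y y z))" for u v :: "'y option"
  have [simp]: "e None None = 0" "e None (Some z) = \<bar>r z\<bar>" "e (Some y) None = \<bar>r y\<bar>"
    "e (Some y) (Some z) = mdist Y y z" for y z by (auto simp: e_def)
  have M: "Metric_space (insert None (Some ` mspace Y)) e"
  proof
    show "0 \<le> e u v" for u v by (cases u; cases v) auto
    show "e u v = e v u" for u v by (cases u; cases v) (auto simp: mdist_commute)
    show "(e u v = 0) = (u = v)" if "u \<in> insert None (Some ` mspace Y)"
      "v \<in> insert None (Some ` mspace Y)" for u v
      using that False by auto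
    show "e u w \<le> e u v + e v w" if "u \<in> insert None (Some ` mspace Y)"
      "v \<in> insert None (Some ` mspace Y)" "w \<in> insert None (Some ` mspace Y)" for u v w
      using that
    proof (elim insertE imageE)
      fix y z assume "y \<in> mspace Y" "z \<in> mspace Y" "u = None" "v = Some y" "w = Some z"
      then show ?thesis using lip[of z y] nn by (simp add: mdist_commute[of Y z])
    next
      fix y z assume "y \<in> mspace Y" "z \<in> mspace Y" "u = Some y" "v = None" "w = Some z"
      then show ?thesis using tri[of y z] nn by simp
    next
      fix y z assume "y \<in> mspace Y" "z \<in> mspace Y" "u = Some y" "v = Some z" "w = None"
      then show ?thesis using lip[of y z] nn by simp
    qed (auto intro: mdist_triangle)
  qed
  define X where "X = metric (insert None (Some ` mspace Y), e)"
  have sp: "mspace X = insert None (Some ` mspace Y)" "mdist X = e"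
    unfolding X_def by (rule Metric_space.mspace_metric[OF M] Metric_space.mdist_metric[OF M])+
  have "one_lipschitz_map (submetric X (Some ` mspace Y)) Y the"
    by (auto simp: one_lipschitz_map_def sp)
  then have "Some ` mspace Y \<subseteq> mspace X \<and>
      one_lipschitz_map (submetric X (Some ` mspace Y)) Y the" by (auto simp: sp)
  from inj[unfolded injective_metric_space_def injective_wrt_def, rule_format, OF this]
  obtain F where F: "one_lipschitz_map X Y F" "\<forall>a\<in>Some ` mspace Y. F a = the a"
    by (elim exE conjE) simp
  show ?thesis
  proof (intro bexI[of _ "F None"] ballI)
    show "F None \<in> mspace Y" using F(1) by (auto simp: one_lipschitz_map_def sp)
    fix y assume y: "y \<in> mspace Y"
    have "mdist Y (F (Some y)) (F None) \<le> e (Some y) None"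
      using F(1) y unfolding one_lipschitz_map_def sp by blast
    then show "mdist Y y (F None) \<le> r y" using F(2) y nn by simp
  qed
qed

lemma injective_metric_space_balls:
  fixes Y :: "'y metric" and S :: "('y \<times> real) set"
  assumes inj: "injective_metric_space Y"
    and S: "S \<subseteq> mspace Y \<times> UNIV"
    and tri: "\<And>y \<rho> z \<rho>'. (y, \<rho>) \<in> S \<Longrightarrow> (z, \<rho>') \<in> S \<Longrightarrow> mdist Y y z \<le> \<rho> + \<rho>'"
  shows "\<exists>p\<in>mspace Y. \<forall>(y, \<rho>)\<in>S. mdist Y y p \<le> \<rho>"
proof (cases "S = {}")
  case True
  then show ?thesis using injective_metric_space_nonempty[OF inj] by auto
next
  case False
  define g where "g y = (\<lambda>q. mdist Y y (fst q) + snd q)" for y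
  define r where "r y = (INF q\<in>S. g y q)" for y
  have snn: "0 \<le> \<rho>" if "(z, \<rho>) \<in> S" for z \<rho>
    using tri[OF that that] mdist_nonneg[of Y z z] by linarith
  have bdd: "bdd_below (g y ` S)" for y
    by (rule bdd_belowI[of _ 0]) (auto simp: g_def dest: snn)
  have le: "r y \<le> mdist Y y z + \<rho>" if "(z, \<rho>) \<in> S" for y z \<rho>
    unfolding r_def using cINF_lower[OF bdd that, of y] by (simp add: g_def)
  have ge: "c \<le> r y" if "\<And>z \<rho>. (z, \<rho>) \<in> S \<Longrightarrow> c \<le> mdist Y y z + \<rho>" for c y
    unfolding r_def using False that by (intro cINF_greatest) (auto simp: g_def)
  have "\<exists>p\<in>mspace Y. \<forall>y\<in>mspace Y. mdist Y y p \<le> r y"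
  proof (rule injective_metric_space_point[OF inj])
    fix y z assume y: "y \<in> mspace Y" and z: "z \<in> mspace Y"
    have "r y - mdist Y y z \<le> r z"
    proof (rule ge)
      fix w \<rho> assume w: "(w, \<rho>) \<in> S"
      then have "mdist Y y w \<le> mdist Y y z + mdist Y z w"
        using S y z by (auto intro: mdist_triangle)
      then show "r y - mdist Y y z \<le> mdist Y z w + \<rho>" using le[OF w, of y] by linarith
    qed
    then show "r y \<le> r z + mdist Y y z" by linarith
    have "mdist Y y z - r y \<le> r z"
    proof (rule ge)
      fix w \<rho> assume w: "(w, \<rho>) \<in> S"
      have "mdist Y y z - (mdist Y z w + \<rho>) \<le> r y"
      proof (rule ge)
        fix v \<rho>' assume v: "(v, \<rho>') \<in> S"
        have "w \<in> mspace Y" "v \<in> mspace Y" using S v w by auto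
        then have "mdist Y y z \<le> mdist Y y v + mdist Y v z" "mdist Y v z \<le> mdist Y v w + mdist Y w z"
          using y z by (auto intro: mdist_triangle)
        then show "mdist Y y z - (mdist Y z w + \<rho>) \<le> mdist Y y v + \<rho>'"
          using tri[OF v w] by (simp add: mdist_commute[of Y z w])
      qed
      then show "mdist Y y z - r y \<le> mdist Y z w + \<rho>" by linarith
    qed
    then show "mdist Y y z \<le> r y + r z" by linarith
  qed
  then obtain p where p: "p \<in> mspace Y" "\<And>y. y \<in> mspace Y \<Longrightarrow> mdist Y y p \<le> r y" by blast
  have "mdist Y y p \<le> \<rho>" if q: "(y, \<rho>) \<in> S" for y \<rho>
  proof -
    have y: "y \<in> mspace Y" using S q by auto
    have "r y \<le> \<rho>" using le[OF q, of y] mdist_zero[OF y y] by simp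
    then show ?thesis using p(2)[OF y] by linarith
  qed
  then show ?thesis using p(1) by blast
qed

theorem injective_metric_space_imp_injective_wrt:
  fixes Y :: "'y metric"
  assumes inj: "injective_metric_space Y"
  shows "injective_wrt TYPE('x) Y"
  unfolding injective_wrt_def
proof (intro allI impI, elim conjE)
  fix X :: "'x metric" and A f
  assume A: "A \<subseteq> mspace X" and f: "one_lipschitz_map (submetric X A) Y f"
  define P where "P G \<longleftrightarrow> G \<subseteq> mspace X \<times> mspace Y \<and>
    (\<forall>(x, y)\<in>G. \<forall>(x', y')\<in>G. mdist Y y y' \<le> mdist X x x')" for G
  define G0 where "G0 = (\<lambda>a. (a, f a)) ` A"
  have G0: "P G0"
    using A f by (auto simp: P_def G0_def one_lipschitz_map_def Pi_iff)
  define \<A> where "\<A> = {G. P (G0 \<union> G)}"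
  have "\<exists>M\<in>\<A>. \<forall>G\<in>\<A>. M \<subseteq> G \<longrightarrow> G = M"
  proof (rule subset_Zorn')
    fix C assume C: "subset.chain \<A> C"
    then have CA: "C \<subseteq> \<A>" and lin: "\<And>G H. G \<in> C \<Longrightarrow> H \<in> C \<Longrightarrow> G \<subseteq> H \<or> H \<subseteq> G"
      by (auto simp: subset_chain_def)
    have "mdist Y y y' \<le> mdist X x x'"
      if xy: "(x, y) \<in> G0 \<union> \<Union>C" "(x', y') \<in> G0 \<union> \<Union>C" for x y x' y'
    proof -
      have PC: "P (G0 \<union> G)" if "G \<in> C" for G
        using CA that unfolding \<A>_def by blast
      have "\<exists>G. P G \<and> (x, y) \<in> G \<and> (x', y') \<in> G"
      proof (cases "(x, y) \<in> G0")
        case 1: True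
        show ?thesis
        proof (cases "(x', y') \<in> G0")
          case True
          with 1 G0 show ?thesis by blast
        next
          case False
          then obtain H where "H \<in> C" "(x', y') \<in> H" using xy by blast
          with 1 PC[of H] show ?thesis by blast
        qed
      next
        case False
        then obtain G where G: "G \<in> C" "(x, y) \<in> G" using xy by blast
        show ?thesis
        proof (cases "(x', y') \<in> G0")
          case True
          with G PC[of G] show ?thesis by blast
        next
          case False
          then obtain H where H: "H \<in> C" "(x', y') \<in> H" using xy by blast
          from lin[OF G(1) H(1)] show ?thesis
          proof
            assume "G \<subseteq> H"
            with G H PC[of H] show ?thesis by blast
          next
            assume "H \<subseteq> G"
            with G H PC[of G] show ?thesis by blast
          qed
        qed
      qed
      then show ?thesis unfolding P_def by blast
    qed
    moreover have "G0 \<union> \<Union>C \<subseteq> mspace X \<times> mspace Y"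
      using G0 CA unfolding \<A>_def P_def by blast
    ultimately show "\<Union>C \<in> \<A>" unfolding \<A>_def P_def by blast
  qed
  then obtain M where M: "M \<in> \<A>" and max: "\<And>G. G \<in> \<A> \<Longrightarrow> M \<subseteq> G \<Longrightarrow> G = M" by blast
  define G where "G = G0 \<union> M"
  have PG: "P G" using M by (simp add: \<A>_def G_def)
  have Gsp: "x \<in> mspace X" "y \<in> mspace Y" if "(x, y) \<in> G" for x y
    using PG that by (auto simp: P_def)
  have Glip: "mdist Y y y' \<le> mdist X x x'" if "(x, y) \<in> G" "(x', y') \<in> G" for x y x' y'
    using PG that by (auto simp: P_def)
  have dom: "\<exists>y. (x, y) \<in> G" if x: "x \<in> mspace X" for x
  proof -
    define S where "S = (\<lambda>(x', y). (y, mdist X x' x)) ` G"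
    have "\<exists>p\<in>mspace Y. \<forall>(y, \<rho>)\<in>S. mdist Y y p \<le> \<rho>"
    proof (rule injective_metric_space_balls[OF inj])
      show "S \<subseteq> mspace Y \<times> UNIV" using Gsp by (auto simp: S_def)
      fix y \<rho> z \<rho>' assume "(y, \<rho>) \<in> S" "(z, \<rho>') \<in> S"
      then obtain u v where u: "(u, y) \<in> G" "\<rho> = mdist X u x" and v: "(v, z) \<in> G" "\<rho>' = mdist X v x"
        by (auto simp: S_def)
      have "mdist X u v \<le> mdist X u x + mdist X x v"
        using Gsp u v x by (auto intro: mdist_triangle)
      then show "mdist Y y z \<le> \<rho> + \<rho>'"
        using Glip[OF u(1) v(1)] u v by (simp add: mdist_commute[of X x v])
    qed
    then obtain p where p: "p \<in> mspace Y" "\<And>u y. (u, y) \<in> G \<Longrightarrow> mdist Y y p \<le> mdist X u x"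
      by (fastforce simp: S_def)
    have p': "mdist Y p y \<le> mdist X x u" if "(u, y) \<in> G" for u y
      using p(2)[OF that] by (simp only: mdist_commute[of Y y p] mdist_commute[of X u x])
    have "mdist Y p p \<le> mdist X x x" using mdist_zero[OF p(1) p(1)] by simp
    then have "P (insert (x, p) G)"
      using PG p(1) x p(2) p' unfolding P_def by blast
    then have "insert (x, p) M \<in> \<A>" by (simp add: \<A>_def G_def)
    from max[OF this] show ?thesis by (auto simp: G_def)
  qed
  then obtain F where F: "\<And>x. x \<in> mspace X \<Longrightarrow> (x, F x) \<in> G" by metis
  have "one_lipschitz_map X Y F"
    using F Gsp Glip unfolding one_lipschitz_map_def by blast
  moreover have "F a = f a" if "a \<in> A" for a
  proof -
    have 1: "(a, F a) \<in> G" "(a, f a) \<in> G" using that A F by (auto simp: G_def G0_def)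
    then have "mdist Y (F a) (f a) \<le> mdist X a a" by (rule Glip)
    moreover have "mdist X a a = 0" using A that mdist_zero[of a X a] by blast
    ultimately have "mdist Y (F a) (f a) = 0"
      using mdist_nonneg[of Y "F a" "f a"] by linarith
    then show ?thesis using Gsp 1 by simp
  qed
  ultimately show "\<exists>F. one_lipschitz_map X Y F \<and> (\<forall>a\<in>A. F a = f a)" by blast
qed


section \<open>Geodesic bicombings\<close>

definition is_geodesic :: "'y metric \<Rightarrow> (real \<Rightarrow> 'y) \<Rightarrow> bool" where
  "is_geodesic Y c \<longleftrightarrow>
     c \<in> {0..1} \<rightarrow> mspace Y \<and>
     (\<forall>s\<in>{0..1}. \<forall>t\<in>{0..1}. mdist Y (c s) (c t) = \<bar>s - t\<bar> * mdist Y (c 0) (c 1))"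

definition bicombing :: "'y metric \<Rightarrow> ('y \<Rightarrow> 'y \<Rightarrow> real \<Rightarrow> 'y) \<Rightarrow> bool" where
  "bicombing Y \<sigma> \<longleftrightarrow>
     (\<forall>x\<in>mspace Y. \<forall>y\<in>mspace Y. is_geodesic Y (\<sigma> x y) \<and> \<sigma> x y 0 = x \<and> \<sigma> x y 1 = y)"

definition conical :: "'y metric \<Rightarrow> ('y \<Rightarrow> 'y \<Rightarrow> real \<Rightarrow> 'y) \<Rightarrow> bool" where
  "conical Y \<sigma> \<longleftrightarrow>
     (\<forall>x\<in>mspace Y. \<forall>y\<in>mspace Y. \<forall>x'\<in>mspace Y. \<forall>y'\<in>mspace Y. \<forall>t\<in>{0..1}.
        mdist Y (\<sigma> x y t) (\<sigma> x' y' t) \<le> (1 - t) * mdist Y x x' + t * mdist Y y y')"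

definition reversible :: "'y metric \<Rightarrow> ('y \<Rightarrow> 'y \<Rightarrow> real \<Rightarrow> 'y) \<Rightarrow> bool" where
  "reversible Y \<sigma> \<longleftrightarrow>
     (\<forall>x\<in>mspace Y. \<forall>y\<in>mspace Y. \<forall>t\<in>{0..1}. \<sigma> x y t = \<sigma> y x (1 - t))"

definition bicombing_convex :: "'y metric \<Rightarrow> ('y \<Rightarrow> 'y \<Rightarrow> real \<Rightarrow> 'y) \<Rightarrow> 'y set \<Rightarrow> bool" where
  "bicombing_convex Y \<sigma> C \<longleftrightarrow>
     C \<subseteq> mspace Y \<and> (\<forall>x\<in>C. \<forall>y\<in>C. \<sigma> x y ` {0..1} \<subseteq> C)"

text \<open>
  For \<open>A \<subseteq> mspace Y\<close> and a bicombing \<open>\<sigma>\<close> on \<open>Y\<close>, the family below contains \<open>mspace Y\<close>, so the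
  intersection is taken over a nonempty family.
\<close>

definition closed_convex_hull :: "'y metric \<Rightarrow> ('y \<Rightarrow> 'y \<Rightarrow> real \<Rightarrow> 'y) \<Rightarrow> 'y set \<Rightarrow> 'y set" where
  "closed_convex_hull Y \<sigma> A =
     \<Inter>{C. closedin (mtopology_of Y) C \<and> bicombing_convex Y \<sigma> C \<and> A \<subseteq> C}"

text \<open>
  An existence statement about metric spaces needs a type from which to draw the points.  We use
  the following type of cardinality \<open>2\<close> to the power of the continuum; none of its structure is
  used, and the metric is arbitrary.
\<close>

type_synonym point = "(nat \<Rightarrow> real) \<Rightarrow> real"

end

theory Submission
  imports Defs
begin

text \<open>
  Binary trees with leaves from a two-point set carry a largest pseudometric for which joining two
  trees is a conical midpoint map, and this free midpoint space is generated by two points.  The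
  distance of two trees is the least probability that two random descents, coupled without
  anticipation, end in different leaves.  A coin flip of one descent can be correlated with a single
  flip of the other only, so a random walk with tiny steps is essentially independent of any given
  tree; hence the space is not totally bounded.

  In the injective hull, realised by tight functions, a reversible conical bicombing is the same as a
  1-Lipschitz map from measures with at most two atoms, with the Wasserstein distance, that fixes Dirac
  measures.  Tight functions are convex along the midpoint map of the original space, so the midpoint
  map extends to such a bicombing by injectivity, and the closed convex hull of the two generators
  contains the whole original space.
\<close>

section \<open>The free midpoint space on two points\<close>

datatype trm = Leaf bool | Mid trm trm

instance trm :: countable
  by countable_datatype

text \<open>
  This is the largest pseudometric on binary trees for which \<open>Mid\<close> is a commutative, idempotent
  and conical midpoint map and distinct leaves have distance at most 1.  The four terms of the
  minimum are the ways of coupling the first coin flips of two random descents: jointly in either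
  orientation, or only one of the two trees moves.
\<close>

fun tdist :: "trm \<Rightarrow> trm \<Rightarrow> real" where
  "tdist (Leaf i) (Leaf j) = of_bool (i \<noteq> j)"
| "tdist (Leaf i) (Mid t1 t2) = (tdist (Leaf i) t1 + tdist (Leaf i) t2) / 2"
| "tdist (Mid s1 s2) (Leaf j) = (tdist s1 (Leaf j) + tdist s2 (Leaf j)) / 2"
| "tdist (Mid s1 s2) (Mid t1 t2) =
     min (min ((tdist s1 t1 + tdist s2 t2) / 2) ((tdist s1 t2 + tdist s2 t1) / 2))
         (min ((tdist s1 (Mid t1 t2) + tdist s2 (Mid t1 t2)) / 2)
              ((tdist (Mid s1 s2) t1 + tdist (Mid s1 s2) t2) / 2))"

section \<open>Pseudometric axioms of the coupling distance\<close>

lemma tdist_nonneg: "0 \<le> tdist s t"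
  by (induction s t rule: tdist.induct) auto

lemma tdist_self [simp]: "tdist t t = 0"
proof (induction t)
  case (Mid t1 t2)
  then have "tdist (Mid t1 t2) (Mid t1 t2) \<le> 0" by simp
  then show ?case by (intro antisym tdist_nonneg)
qed auto

lemma tdist_commute: "tdist s t = tdist t s"
proof (induction s t rule: tdist.induct)
  case (4 s1 s2 t1 t2)
  then show ?case by (simp only: tdist.simps) (simp add: algebra_simps min.commute min.left_commute)
qed auto

text \<open>Forgetting the order of the subtrees turns the two orientations of a joint move into one
  case.\<close>

definition halves :: "trm \<Rightarrow> trm \<Rightarrow> trm \<Rightarrow> bool" where
  "halves t t1 t2 \<longleftrightarrow> t = Mid t1 t2 \<or> t = Mid t2 t1"

lemma size_halves: "halves t t1 t2 \<Longrightarrow> size t1 < size t \<and> size t2 < size t"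
  by (auto simp: halves_def)

lemma tdist_halves_left: "halves s s1 s2 \<Longrightarrow> tdist s t \<le> (tdist s1 t + tdist s2 t) / 2"
  by (cases t) (auto simp: halves_def min_def)

lemma tdist_halves_right: "halves t t1 t2 \<Longrightarrow> tdist s t \<le> (tdist s t1 + tdist s t2) / 2"
  using tdist_halves_left[of t t1 t2 s] by (simp add: tdist_commute)

lemma tdist_halves:
  "halves s s1 s2 \<Longrightarrow> halves t t1 t2 \<Longrightarrow> tdist s t \<le> (tdist s1 t1 + tdist s2 t2) / 2"
  by (auto simp: halves_def min_def)

lemma tdist_Mid_cases [consumes 0, case_names left right both]:
  obtains s1 s2 where "halves s s1 s2" "tdist s (Mid t1 t2) = (tdist s1 (Mid t1 t2) + tdist s2 (Mid t1 t2)) / 2"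
  | "tdist s (Mid t1 t2) = (tdist s t1 + tdist s t2) / 2"
  | s1 s2 where "halves s s1 s2" "tdist s (Mid t1 t2) = (tdist s1 t1 + tdist s2 t2) / 2"
proof (cases s)
  case (Leaf i)
  then show ?thesis by (intro that(2)) simp
next
  case (Mid s1 s2)
  have "halves s s1 s2" "halves s s2 s1" by (auto simp: halves_def Mid)
  moreover have "tdist s (Mid t1 t2) \<in> {(tdist s1 t1 + tdist s2 t2) / 2, (tdist s2 t1 + tdist s1 t2) / 2,
      (tdist s1 (Mid t1 t2) + tdist s2 (Mid t1 t2)) / 2, (tdist s t1 + tdist s t2) / 2}"
    unfolding Mid tdist.simps(4) min_def by (auto split: if_splits)
  ultimately show ?thesis using that by blast
qed

text \<open>Optimal couplings of \<open>s\<close> with \<open>r\<close> and of \<open>r\<close> with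
  \<open>t\<close> are glued. A lone move of \<open>s\<close> or \<open>t\<close> is made first;
  otherwise both couplings move \<open>r\<close>, and its halves serve as common index.\<close>

lemma tdist_triangle: "tdist s t \<le> tdist s r + tdist r t"
proof (induction "size s + size r + size t" arbitrary: s r t rule: less_induct)
  case less
  note IH = less[rule_format]
  have unfold_left: ?case if "halves s s1 s2" "tdist s r = (tdist s1 r + tdist s2 r) / 2" for s1 s2
    using IH[of s1 r t] IH[of s2 r t] size_halves[OF that(1)] tdist_halves_left[OF that(1), of t] that(2)
    by simp
  have unfold_right: ?case if "halves t t1 t2" "tdist r t = (tdist r t1 + tdist r t2) / 2" for t1 t2
    using IH[of s r t1] IH[of s r t2] size_halves[OF that(1)] tdist_halves_right[OF that(1), of s] that(2)
    by simp
  show ?case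
  proof (cases r)
    case (Leaf j)
    show ?thesis
    proof (cases s)
      case (Mid s1 s2)
      with Leaf show ?thesis by (intro unfold_left[of s1 s2]) (auto simp: halves_def)
    next
      case s: (Leaf i)
      show ?thesis
      proof (cases t)
        case (Mid t1 t2)
        with Leaf show ?thesis by (intro unfold_right[of t1 t2]) (auto simp: halves_def)
      next
        case (Leaf k)
        with s \<open>r = Leaf j\<close> show ?thesis by auto
      qed
    qed
  next
    case r: (Mid r1 r2)
    have tr: "tdist r t = tdist t (Mid r1 r2)" by (simp add: r tdist_commute)
    show ?thesis
    proof (cases rule: tdist_Mid_cases[of s r1 r2])
      case (left s1 s2)
      with r show ?thesis by (intro unfold_left[of s1 s2]) auto
    next
      case s: right
      show ?thesis
      proof (cases rule: tdist_Mid_cases[of t r1 r2])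
        case (left t1 t2)
        with r tr show ?thesis by (intro unfold_right[of t1 t2]) (auto simp: tdist_commute)
      next
        case right
        with s r tr IH[of s r1 t] IH[of s r2 t] show ?thesis by (simp add: tdist_commute)
      next
        case (both t1 t2)
        with s r tr IH[of s r1 t1] IH[of s r2 t2] size_halves[OF both(1)] tdist_halves_right[OF both(1), of s]
        show ?thesis by (simp add: tdist_commute)
      qed
    next
      case s: (both s1 s2)
      show ?thesis
      proof (cases rule: tdist_Mid_cases[of t r1 r2])
        case (left t1 t2)
        with r tr show ?thesis by (intro unfold_right[of t1 t2]) (auto simp: tdist_commute)
      next
        case right
        with s r tr IH[of s1 r1 t] IH[of s2 r2 t] size_halves[OF s(1)] tdist_halves_left[OF s(1), of t]
        show ?thesis by (simp add: tdist_commute)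
      next
        case (both t1 t2)
        with s r tr IH[of s1 r1 t1] IH[of s2 r2 t2] size_halves[OF both(1)] size_halves[OF s(1)]
          tdist_halves[OF s(1) both(1)]
        show ?thesis by (simp add: tdist_commute)
      qed
    qed
  qed
qed

section \<open>Random walks stay far from shallow trees\<close>

fun weight :: "trm \<Rightarrow> real" where
  "weight (Leaf i) = of_bool i"
| "weight (Mid s t) = (weight s + weight t) / 2"

lemma weight_bounds: "0 \<le> weight t" "weight t \<le> 1"
  by (induction t) auto

fun depth :: "trm \<Rightarrow> nat" where
  "depth (Leaf i) = 0"
| "depth (Mid s t) = Suc (max (depth s) (depth t))"

lemma depth_halves: "halves t t1 t2 \<Longrightarrow> Suc (depth t1) \<le> depth t \<and> Suc (depth t2) \<le> depth t"
  by (auto simp: halves_def)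

lemma weight_halves: "halves t t1 t2 \<Longrightarrow> weight t = (weight t1 + weight t2) / 2"
  by (auto simp: halves_def)

text \<open>
  The symmetric random walk with step \<open>1 / K\<close> started at \<open>j / K\<close>, absorbed in \<open>0\<close> and \<open>1\<close>, and
  cut off after \<open>n\<close> steps.
\<close>

fun walk :: "nat \<Rightarrow> nat \<Rightarrow> nat \<Rightarrow> trm" where
  "walk K 0 j = Leaf (j = K)"
| "walk K (Suc n) j =
     (if 0 < j \<and> j < K then Mid (walk K n (j - 1)) (walk K n (j + 1)) else Leaf (j = K))"

lemma tdist_Leaf: "tdist s (Leaf i) = weight s + of_bool i - 2 * weight s * of_bool i"
  by (induction s) (auto simp: field_simps)

text \<open>
  If the two descents were independent, \<open>s\<close> and the walk would end in different leaves with
  probability \<open>p + x - 2 p x\<close>, where \<open>p = weight s\<close> and \<open>x = j / K\<close>.  Each of the at most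
  \<open>depth s\<close> joint moves changes this by at most \<open>1 / K\<close>, and \<open>j (K - j)\<close> is the expected
  absorption time, which controls the cut-off by Markov's inequality.
\<close>

lemma tdist_walk:
  assumes "j \<le> K" "0 < K"
  shows "weight s + real j / K - 2 * weight s * (real j / K)
           \<le> tdist s (walk K n j) + real (depth s) / K + real (j * (K - j)) / (n + 1)"
  using assms(1)
proof (induction "size s + n" arbitrary: s n j rule: less_induct)
  case less
  define L where "L s' j' = weight s' + real j' / K - 2 * weight s' * (real j' / K)" for s' and j' :: nat
  define E where "E n' j' = real (j' * (K - j')) / (n' + 1)" for n' j' :: nat
  have IH: "L s' j' \<le> tdist s' (walk K n' j') + real (depth s') / K + E n' j'"
    if "size s' + n' < size s + n" "j' \<le> K" for s' n' j'
    unfolding L_def E_def by (rule less(1)[OF that])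
  have avg: "(a + b) / 2 + y - 2 * ((a + b) / 2) * y = ((a + y - 2 * a * y) + (b + y - 2 * b * y)) / 2"
    for a b y :: real by (simp add: field_simps)
  have L_halves: "L t j' = (L t1 j' + L t2 j') / 2" if "halves t t1 t2" for t t1 t2 j'
    unfolding L_def weight_halves[OF that] by (rule avg)
  have "L s j \<le> tdist s (walk K n j) + real (depth s) / K + E n j"
  proof (cases "j = 0 \<or> j = K")
    case True
    then have "walk K n j = Leaf (j = K)" "real j / K = of_bool (j = K)" using \<open>0 < K\<close>
      by (cases n; auto)+
    then show ?thesis by (simp add: L_def E_def tdist_Leaf)
  next
    case False
    then have j: "0 < j" "j < K" using less.prems by auto
    show ?thesis
    proof (cases "n + 1 \<le> j * (K - j)")
      \<comment> \<open>The cut-off error is at least 1 here, while \<open>L s j\<close> is at most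
        1.\<close>
      case True
      define y where "y = real j / K"
      have "0 \<le> y" "y \<le> 1" using j by (auto simp: y_def)
      then have "0 \<le> weight s * y + (1 - weight s) * (1 - y)"
        using weight_bounds[of s] by (intro add_nonneg_nonneg mult_nonneg_nonneg) auto
      moreover have "L s j = 1 - (weight s * y + (1 - weight s) * (1 - y))"
        unfolding L_def y_def[symmetric] by (simp add: algebra_simps)
      ultimately have "L s j \<le> 1" by linarith
      moreover have "1 \<le> E n j" using True unfolding E_def
        by (subst le_divide_eq_1_pos) (simp_all only: of_nat_le_iff of_nat_0_less_iff)
      moreover have "0 \<le> real (depth s) / K" by simp
      ultimately show ?thesis using tdist_nonneg[of s "walk K n j"] by linarith
    next
      case small: False
      have "1 \<le> j * (K - j)" using j by simp
      then obtain m where n: "n = Suc m" using small by (cases n) auto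
      define w1 w2 where "w1 = walk K m (j - 1)" and "w2 = walk K m (j + 1)"
      have jK: "j - 1 \<le> K" "j + 1 \<le> K" using j by auto
      have w: "walk K n j = Mid w1 w2" using j by (simp add: n w1_def w2_def)
      \<comment> \<open>Averaging \<open>j * (K - j)\<close> over the two neighbours of
        \<open>j\<close> lowers it by 1. As \<open>x < n + 1\<close>, this makes up for the
        denominator dropping from \<open>n + 1\<close> to \<open>m + 1\<close>.\<close>
      define x where "x = real j * real (K - j)"
      have "real ((j - 1) * (K - (j - 1))) + real ((j + 1) * (K - (j + 1))) = 2 * (x - 1)"
      proof -
        obtain i l where "j = Suc i" "K = Suc i + Suc l"
          using j by (metis Suc_pred less_imp_add_positive)
        then show ?thesis by (simp add: x_def algebra_simps)
      qed
      then have e: "(E m (j - 1) + E m (j + 1)) / 2 = (x - 1) / (m + 1)"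
        unfolding E_def add_divide_distrib[symmetric] by (simp only:) (simp add: field_simps)
      have "x < real (n + 1)" using small unfolding x_def of_nat_mult[symmetric] of_nat_less_iff by simp
      then have "(x - 1) / (m + 1) \<le> x / (n + 1)" by (simp add: n field_simps)
      then have e: "(E m (j - 1) + E m (j + 1)) / 2 \<le> E n j"
        unfolding e by (simp add: E_def x_def)
      have L1: "L s' (j - 1) = L s' j - (1 - 2 * weight s') / K"
       and L2: "L s' (j + 1) = L s' j + (1 - 2 * weight s') / K" for s'
        using j by (simp_all add: L_def of_nat_diff field_simps)
      \<comment> \<open>\<open>L\<close> is affine in the weight and in the position, so lone moves
        preserve its average. A joint move adds the covariance \<open>\<eta>\<close>, of size at
        most \<open>1 / K\<close>, which the smaller depth of the halves pays for.\<close>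
      show ?thesis
      proof (cases rule: tdist_Mid_cases[of s w1 w2])
        case (left s1 s2)
        have "L s j = (L s1 j + L s2 j) / 2" by (rule L_halves[OF left(1)])
        moreover have "real (depth s1) / K \<le> real (depth s) / K" "real (depth s2) / K \<le> real (depth s) / K"
          using depth_halves[OF left(1)] by (auto intro!: divide_right_mono)
        ultimately show ?thesis using IH[of s1 n j] IH[of s2 n j] size_halves[OF left(1)] j left(2)
          unfolding w by simp
      next
        case right
        then show ?thesis using IH[of s m "j - 1", OF _ jK(1)] IH[of s m "j + 1", OF _ jK(2)] e
          unfolding w L1 L2 w1_def[symmetric] w2_def[symmetric]
          by (simp add: n)
      next
        case (both s1 s2)
        define \<eta> where "\<eta> = (weight s1 - weight s2) / K"
        have "(weight s2 - weight s1) / K \<le> 1 / K"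
          using weight_bounds[of s1] weight_bounds[of s2] by (intro divide_right_mono) auto
        then have \<eta>: "- \<eta> \<le> 1 / K" by (simp add: \<eta>_def diff_divide_distrib)
        have "L s j = (L s1 j + L s2 j) / 2" by (rule L_halves[OF both(1)])
        then have "L s j = (L s1 (j - 1) + L s2 (j + 1)) / 2 - \<eta>"
          unfolding L1 L2 by (simp add: \<eta>_def diff_divide_distrib add_divide_distrib)
        moreover have "real (depth s1) / K + 1 / K \<le> real (depth s) / K"
           "real (depth s2) / K + 1 / K \<le> real (depth s) / K"
          using depth_halves[OF both(1)] unfolding add_divide_distrib[symmetric]
          by (auto intro!: divide_right_mono)
        moreover have "L s1 (j - 1) \<le> tdist s1 w1 + real (depth s1) / K + E m (j - 1)"
          "L s2 (j + 1) \<le> tdist s2 w2 + real (depth s2) / K + E m (j + 1)"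
          unfolding w1_def w2_def using size_halves[OF both(1)] jK by (auto intro!: IH simp: n)
        ultimately show ?thesis using e \<eta> both(2) unfolding w by argo
      qed
    qed
  qed
  then show ?case unfolding L_def E_def .
qed

text \<open>For a walk started at \<open>1 / 2\<close> the independent value is \<open>1 / 2\<close>
  whatever the weight of \<open>s\<close>. The error depends on \<open>s\<close> only through its
  depth, so one walk serves all of \<open>F\<close>.\<close>

lemma tdist_separated:
  assumes "finite F"
  shows "\<exists>t. \<forall>s\<in>F. 1 / 4 \<le> tdist s t"
proof -
  obtain N where N: "\<And>s. s \<in> F \<Longrightarrow> depth s \<le> N"
    using finite_nat_set_iff_bounded_le[of "depth ` F"] assms by auto
  \<comment> \<open>Step size \<open>1 / (2 * k)\<close> keeps the depth error within
    \<open>1 / 8\<close>. The expected absorption time is \<open>k * k\<close>, so a cut-off after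
    \<open>8 * k * k\<close> steps costs at most \<open>1 / 8\<close> more.\<close>
  define k where "k = 4 * (N + 1)"
  have k: "0 < k" "8 * (real N + 1) = 2 * k" by (simp_all add: k_def)
  have "1 / 4 \<le> tdist s (walk (2 * k) (8 * k * k) k)" if "s \<in> F" for s
  proof -
    have "real (depth s) / real (2 * k) \<le> real N / real (2 * k)"
      using N[OF that] by (intro divide_right_mono) auto
    also have "\<dots> \<le> 1 / 8" by (simp add: k_def field_simps)
    finally have depth: "real (depth s) / real (2 * k) \<le> 1 / 8" .
    have error: "real (k * (2 * k - k)) / real (8 * k * k + 1) \<le> 1 / 8"
    proof (subst pos_divide_le_eq)
      show "0 < real (8 * k * k + 1)" by (simp only: of_nat_0_less_iff)
    qed simp
    have half: "real k / real (2 * k) = 1 / 2" using k by simp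
    have "k \<le> 2 * k" "0 < 2 * k" using k by auto
    from tdist_walk[OF this, of s "8 * k * k", unfolded half]
    have "weight s + 1 / 2 - 2 * weight s * (1 / 2)
        \<le> tdist s (walk (2 * k) (8 * k * k) k) + 1 / 8 + 1 / 8"
      by (rule order_trans[OF _ add_mono[OF add_mono[OF order_refl depth] error]])
    then show ?thesis by simp
  qed
  then show ?thesis by blast
qed

section \<open>The injective hull\<close>

text \<open>Points at distance 0 induce the same function \<open>d u\<close>, so the trees need no
  quotient.\<close>

locale pseudometric =
  fixes d :: "'a \<Rightarrow> 'a \<Rightarrow> real"
  assumes d_self [simp]: "d x x = 0"
    and d_commute: "d x y = d y x"
    and d_triangle: "d x z \<le> d x y + d y z"
begin

section \<open>Tight functions: the minimal dominating ones, forming Isbell's injective hull\<close>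

definition dominating :: "('a \<Rightarrow> real) set" where
  "dominating = {f. \<forall>x y. d x y \<le> f x + f y}"

definition conjugate :: "('a \<Rightarrow> real) \<Rightarrow> 'a \<Rightarrow> real" where
  "conjugate f x = (SUP y. d x y - f y)"

definition tight :: "('a \<Rightarrow> real) set" where
  "tight = {f \<in> dominating. conjugate f = f}"

lemma dominatingD: "f \<in> dominating \<Longrightarrow> d x y \<le> f x + f y"
  by (simp add: dominating_def)

lemma dominating_nonneg: "f \<in> dominating \<Longrightarrow> 0 \<le> f x"
  using dominatingD[of f x x] by simp

lemma tight_dominating: "f \<in> tight \<Longrightarrow> f \<in> dominating"
  by (simp add: tight_def)

lemma conjugate_upper:
  assumes "f \<in> dominating"
  shows "d x y - f y \<le> conjugate f x"
  unfolding conjugate_def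
proof (rule cSUP_upper)
  show "bdd_above (range (\<lambda>y. d x y - f y))"
    using dominatingD[OF assms, of x] by (intro bdd_aboveI[of _ "f x"]) (auto simp: algebra_simps)
qed auto

lemma conjugate_least: "(\<And>y. d x y - f y \<le> c) \<Longrightarrow> conjugate f x \<le> c"
  unfolding conjugate_def by (intro cSUP_least) auto

lemma conjugate_le: "f \<in> dominating \<Longrightarrow> conjugate f x \<le> f x"
  using dominatingD[of f x] by (intro conjugate_least) (auto simp: algebra_simps)

lemma conjugate_antimono:
  assumes "f \<in> dominating" "\<And>x. f x \<le> g x + c"
  shows "conjugate g x \<le> conjugate f x + c"
proof (rule conjugate_least)
  show "d x y - g y \<le> conjugate f x + c" for y
    using conjugate_upper[OF assms(1), of x y] assms(2)[of y] by linarith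
qed

lemma tightI: "f \<in> dominating \<Longrightarrow> (\<And>x. f x \<le> conjugate f x) \<Longrightarrow> f \<in> tight"
  using conjugate_le[of f] by (auto simp: tight_def fun_eq_iff intro!: antisym)

lemma tight_least: "f \<in> tight \<Longrightarrow> (\<And>y. d x y - f y \<le> c) \<Longrightarrow> f x \<le> c"
  using conjugate_least[of x f c] by (simp add: tight_def)

lemma tight_lipschitz: "f \<in> tight \<Longrightarrow> f x \<le> f y + d x y"
proof (rule tight_least)
  fix z assume "f \<in> tight"
  then show "d x z - f z \<le> f y + d x y"
    using d_triangle[of x z y] dominatingD[OF tight_dominating, of f y z] by linarith
qed

text \<open>A tight \<open>f\<close> is the supremum over \<open>y\<close> of
  \<open>d x y - f y\<close>; each of these functions is below \<open>f\<close> and satisfies the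
  inequality at \<open>w\<close>.\<close>

lemma tight_convex:
  assumes "f \<in> tight" "\<And>y. d w y \<le> (d u y + d v y) / 2"
  shows "f w \<le> (f u + f v) / 2"
proof (rule tight_least[OF assms(1)])
  fix y
  show "d w y - f y \<le> (f u + f v) / 2"
    using assms(2)[of y] dominatingD[OF tight_dominating[OF assms(1)], of u y]
      dominatingD[OF tight_dominating[OF assms(1)], of v y] by argo
qed

lemma kuratowski_tight: "d u \<in> tight"
proof (rule tightI)
  show "d u \<in> dominating"
    using d_triangle[of _ _ u] by (simp add: dominating_def d_commute[of u])
  then show "d u x \<le> conjugate (d u) x" for x
    using conjugate_upper[of "d u" x u] by (simp add: d_commute)
qed

text \<open>Dress's retraction onto the tight functions iterates \<open>f \<mapsto> (f + f\<^sup>*) / 2\<close>.\<close>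

definition average :: "('a \<Rightarrow> real) \<Rightarrow> 'a \<Rightarrow> real" where
  "average f x = (f x + conjugate f x) / 2"

lemma average_dominating:
  assumes "f \<in> dominating"
  shows "average f \<in> dominating"
proof -
  have "d x y \<le> average f x + average f y" for x y
    using conjugate_upper[OF assms, of x y] conjugate_upper[OF assms, of y x]
    by (simp add: average_def d_commute[of y x] field_simps)
  then show ?thesis by (simp add: dominating_def)
qed

lemma average_le: "f \<in> dominating \<Longrightarrow> average f x \<le> f x"
  using conjugate_le[of f x] by (simp add: average_def)

text \<open>Both inequalities are assumed because conjugation reverses the order.\<close>

lemma average_lipschitz:
  assumes "f \<in> dominating" "g \<in> dominating" "\<And>x. f x \<le> g x + c" "\<And>x. g x \<le> f x + c"
  shows "average f x \<le> average g x + c"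
  using conjugate_antimono[OF assms(2,4), of x] assms(3)[of x] by (simp add: average_def field_simps)

text \<open>Averaging lowers \<open>f\<close>, hence does not lower its conjugate, and moves
  \<open>f\<close> halfway towards it.\<close>

lemma average_gap:
  assumes "f \<in> dominating"
  shows "average f x - conjugate (average f) x \<le> (f x - conjugate f x) / 2"
  using conjugate_antimono[OF average_dominating[OF assms], of f 0 x] average_le[OF assms]
  by (simp add: average_def field_simps)

lemma iterate_dominating: "f \<in> dominating \<Longrightarrow> (average ^^ n) f \<in> dominating"
  by (induction n) (auto intro: average_dominating)

lemma iterate_gap:
  assumes "f \<in> dominating"
  shows "(average ^^ n) f x - conjugate ((average ^^ n) f) x \<le> (f x - conjugate f x) / 2 ^ n"
proof (induction n)
  case (Suc n)
  have "(average ^^ Suc n) f x - conjugate ((average ^^ Suc n) f) x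
      \<le> ((average ^^ n) f x - conjugate ((average ^^ n) f) x) / 2"
    using average_gap[OF iterate_dominating[OF assms], of n x] by simp
  also have "\<dots> \<le> (f x - conjugate f x) / 2 ^ n / 2"
    using Suc by (intro divide_right_mono) auto
  finally show ?case by (simp add: mult.commute)
qed simp

lemma iterate_lipschitz:
  assumes "f \<in> dominating" "g \<in> dominating" "\<And>x. f x \<le> g x + c" "\<And>x. g x \<le> f x + c"
  shows "(average ^^ n) f x \<le> (average ^^ n) g x + c \<and> (average ^^ n) g x \<le> (average ^^ n) f x + c"
proof (induction n arbitrary: x)
  case (Suc n)
  then show ?case
    using assms by (auto intro!: average_lipschitz iterate_dominating)
qed (use assms in auto)

definition retract :: "('a \<Rightarrow> real) \<Rightarrow> 'a \<Rightarrow> real" where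
  "retract f x = lim (\<lambda>n. (average ^^ n) f x)"

lemma iterate_decseq:
  assumes "f \<in> dominating"
  shows "decseq (\<lambda>n. (average ^^ n) f x)"
  by (rule decseq_SucI) (simp add: average_le iterate_dominating[OF assms])

lemma retract_LIMSEQ:
  assumes "f \<in> dominating"
  shows "(\<lambda>n. (average ^^ n) f x) \<longlonglongrightarrow> retract f x"
proof -
  have "convergent (\<lambda>n. (average ^^ n) f x)"
    using iterate_decseq[OF assms] dominating_nonneg[OF iterate_dominating[OF assms]]
    by (metis decseq_convergent convergentI)
  then show ?thesis by (simp add: retract_def convergent_LIMSEQ_iff)
qed

lemma retract_tight:
  assumes f: "f \<in> dominating"
  shows "retract f \<in> tight"
proof (rule tightI)
  have "d x y \<le> retract f x + retract f y" for x y
    using dominatingD[OF iterate_dominating[OF f]]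
    by (intro LIMSEQ_le_const[OF tendsto_add[OF retract_LIMSEQ[OF f] retract_LIMSEQ[OF f]]]) auto
  then show dom: "retract f \<in> dominating" by (simp add: dominating_def)
  fix x
  \<comment> \<open>The limit is below every iterate, so its conjugate is above theirs, and the gap
    of the iterates tends to 0.\<close>
  have le: "retract f y \<le> (average ^^ n) f y" for n y
    by (rule decseq_ge[OF iterate_decseq[OF f] retract_LIMSEQ[OF f]])
  have "(average ^^ n) f x - (f x - conjugate f x) / 2 ^ n \<le> conjugate (retract f) x" for n
    using iterate_gap[OF f, of n x] conjugate_antimono[OF dom, of "(average ^^ n) f" 0 x] le by simp
  moreover have "(\<lambda>n. (average ^^ n) f x - (f x - conjugate f x) / 2 ^ n) \<longlonglongrightarrow> retract f x - 0"
    by (intro tendsto_diff retract_LIMSEQ[OF f] LIMSEQ_divide_realpow_zero) auto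
  ultimately show "retract f x \<le> conjugate (retract f) x"
    using LIMSEQ_le_const2 by fastforce
qed

lemma retract_lipschitz:
  assumes "f \<in> dominating" "g \<in> dominating" "\<And>x. f x \<le> g x + c" "\<And>x. g x \<le> f x + c"
  shows "retract f x \<le> retract g x + c"
  using iterate_lipschitz[OF assms]
  by (intro LIMSEQ_le[OF retract_LIMSEQ tendsto_add[OF retract_LIMSEQ tendsto_const]] assms) auto

lemma retract_id:
  assumes "f \<in> tight"
  shows "retract f = f"
proof -
  have "average f = f" using assms by (auto simp: average_def tight_def)
  then have "(average ^^ n) f = f" for n by (induction n) auto
  then show ?thesis by (auto simp: retract_def)
qed

text \<open>McShane's infimum formula, applied at each \<open>x\<close>, gives dominating functions;
  the retraction makes them tight without increasing distances or moving the prescribed values.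
  \<open>D\<close> is only a pseudometric, since different triples will encode one measure.
  \<open>R\<close> is a relation whose consistency follows from \<open>R_lip\<close>.\<close>

lemma tight_extension:
  fixes D :: "'z \<Rightarrow> 'z \<Rightarrow> real" and R :: "('z \<times> ('a \<Rightarrow> real)) set"
  assumes D_self: "\<And>z. z \<in> Z \<Longrightarrow> D z z = 0"
    and D_nonneg: "\<And>z w. z \<in> Z \<Longrightarrow> w \<in> Z \<Longrightarrow> 0 \<le> D z w"
    and D_commute: "\<And>z w. z \<in> Z \<Longrightarrow> w \<in> Z \<Longrightarrow> D z w = D w z"
    and D_triangle: "\<And>z w v. z \<in> Z \<Longrightarrow> w \<in> Z \<Longrightarrow> v \<in> Z \<Longrightarrow> D z v \<le> D z w + D w v"
    and R: "R \<subseteq> Z \<times> tight" "R \<noteq> {}"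
    and R_lip: "\<And>z f w g x. (z, f) \<in> R \<Longrightarrow> (w, g) \<in> R \<Longrightarrow> f x \<le> g x + D z w"
  obtains \<Phi> where "\<And>z. z \<in> Z \<Longrightarrow> \<Phi> z \<in> tight"
    and "\<And>z w x. z \<in> Z \<Longrightarrow> w \<in> Z \<Longrightarrow> \<Phi> z x \<le> \<Phi> w x + D z w"
    and "\<And>z f. (z, f) \<in> R \<Longrightarrow> \<Phi> z = f"
proof -
  have RZ: "w \<in> Z" "f \<in> tight" "f \<in> dominating" if "(w, f) \<in> R" for w f
    using R that tight_dominating by auto
  define g where "g z x p = snd p x + D (fst p) z" for z x and p :: "'z \<times> ('a \<Rightarrow> real)"
  define G where "G z x = (INF p\<in>R. g z x p)" for z x
  have bdd: "bdd_below (g z x ` R)" if "z \<in> Z" for z x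
  proof (rule bdd_belowI[of _ 0], elim imageE)
    fix y p assume "y = g z x p" "p \<in> R"
    then show "0 \<le> y"
      using dominating_nonneg[OF RZ(3), of "fst p" "snd p" x] D_nonneg[OF RZ(1) that, of "fst p" "snd p"]
      by (simp add: g_def)
  qed
  have le: "G z x \<le> f x + D w z" if "z \<in> Z" "(w, f) \<in> R" for z x w f
    unfolding G_def using cINF_lower[OF bdd[OF that(1)] that(2), of x] by (simp add: g_def)
  have ge: "c \<le> G z x" if "\<And>w f. (w, f) \<in> R \<Longrightarrow> c \<le> f x + D w z" for c z x
    unfolding G_def using R(2) that by (intro cINF_greatest) (auto simp: g_def)
  have dom: "G z \<in> dominating" if z: "z \<in> Z" for z
  proof -
    have "d x y \<le> G z x + G z y" for x y
    proof -
      have "d x y - G z y \<le> G z x"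
      proof (rule ge)
        fix w f assume w: "(w, f) \<in> R"
        have "d x y - (f x + D w z) \<le> G z y"
        proof (rule ge)
          fix v h assume v: "(v, h) \<in> R"
          show "d x y - (f x + D w z) \<le> h y + D v z"
            using R_lip[OF w v, of y] dominatingD[OF RZ(3)[OF w], of x y] D_triangle[of w z v]
              D_commute[of v z] RZ(1)[OF w] RZ(1)[OF v] z by linarith
        qed
        then show "d x y - G z y \<le> f x + D w z" by linarith
      qed
      then show ?thesis by linarith
    qed
    then show ?thesis by (simp add: dominating_def)
  qed
  have lip: "G z x \<le> G w x + D z w" if zw: "z \<in> Z" "w \<in> Z" for z w x
  proof -
    have "G z x - D z w \<le> G w x"
    proof (rule ge)
      fix v f assume v: "(v, f) \<in> R"
      show "G z x - D z w \<le> f x + D v w"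
        using le[OF zw(1) v, of x] D_triangle[of v w z] D_commute[of w z] RZ(1)[OF v] zw by linarith
    qed
    then show ?thesis by linarith
  qed
  have ext: "G z = f" if z: "(z, f) \<in> R" for z f
  proof (intro ext antisym)
    show "G z x \<le> f x" for x using le[OF RZ(1)[OF z] z] D_self[OF RZ(1)[OF z]] by simp
    show "f x \<le> G z x" for x
      using R_lip[OF z] D_commute RZ(1)[OF z] by (intro ge) (metis RZ(1))
  qed
  show ?thesis
  proof (rule that[of "\<lambda>z. retract (G z)"])
    show "retract (G z) \<in> tight" if "z \<in> Z" for z
      by (rule retract_tight[OF dom[OF that]])
    show "retract (G z) x \<le> retract (G w) x + D z w" if "z \<in> Z" "w \<in> Z" for z w x
      using lip that D_commute by (intro retract_lipschitz dom) metis+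
    show "retract (G z) = f" if "(z, f) \<in> R" for z f
      using ext[OF that] retract_id RZ(2)[OF that] by simp
  qed
qed

text \<open>
  The outer absolute value is only there to make \<open>hdist\<close> nonnegative on functions that are not
  tight, where the supremum may be over an unbounded set.
\<close>

definition hdist :: "('a \<Rightarrow> real) \<Rightarrow> ('a \<Rightarrow> real) \<Rightarrow> real" where
  "hdist f g = \<bar>SUP x. \<bar>f x - g x\<bar>\<bar>"

section \<open>The supremum metric and injectivity\<close>

lemma tight_diff_bound:
  assumes "f \<in> tight" "g \<in> tight"
  shows "\<bar>f x - g x\<bar> \<le> f y + g y"
  using tight_lipschitz[OF assms(1), of x y] tight_lipschitz[OF assms(2), of x y]
    dominatingD[OF tight_dominating[OF assms(1)], of x y] dominatingD[OF tight_dominating[OF assms(2)], of x y]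
  by linarith

lemma hdist_upper_abs:
  assumes "f \<in> tight" "g \<in> tight"
  shows "\<bar>f x - g x\<bar> \<le> hdist f g"
proof -
  have "bdd_above (range (\<lambda>x. \<bar>f x - g x\<bar>))"
    using tight_diff_bound[OF assms] by (intro bdd_aboveI) auto
  from cSUP_upper[OF _ this, of x] show ?thesis unfolding hdist_def by force
qed

lemma hdist_upper: "f \<in> tight \<Longrightarrow> g \<in> tight \<Longrightarrow> f x \<le> g x + hdist f g"
  using hdist_upper_abs[of f g x] by linarith

text \<open>A one-sided bound suffices: conjugating \<open>f \<le> g + c\<close> yields
  \<open>g \<le> f + c\<close>.\<close>

lemma hdist_least:
  assumes "f \<in> tight" "g \<in> tight" "\<And>x. f x \<le> g x + c"
  shows "hdist f g \<le> c"
proof -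
  have "g x \<le> f x + c" for x
    using conjugate_antimono[of f g c x] assms by (simp add: tight_def)
  then have "\<bar>f x - g x\<bar> \<le> c" for x
    using assms(3)[of x] by (metis abs_le_iff diff_le_eq minus_diff_eq add.commute)
  then have "(SUP x. \<bar>f x - g x\<bar>) \<le> c" "0 \<le> c" by (auto intro!: cSUP_least) force
  moreover have "0 \<le> (SUP x. \<bar>f x - g x\<bar>)"
    using tight_diff_bound[OF assms(1,2)] by (intro cSUP_upper2[of _ _ undefined] bdd_aboveI) auto
  ultimately show ?thesis by (simp add: hdist_def)
qed

sublocale tight: Metric_space tight hdist
proof
  show "0 \<le> hdist f g" for f g by (simp add: hdist_def)
  show "hdist f g = hdist g f" for f g by (simp add: hdist_def abs_minus_commute)
  show "(hdist f g = 0) = (f = g)" if "f \<in> tight" "g \<in> tight" for f g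
  proof
    assume "hdist f g = 0"
    then show "f = g" using hdist_upper_abs[OF that] by (intro ext) simp
  qed (simp add: hdist_def)
  show "hdist f h \<le> hdist f g + hdist g h" if "f \<in> tight" "g \<in> tight" "h \<in> tight" for f g h
  proof (rule hdist_least[OF that(1,3)])
    show "f x \<le> h x + (hdist f g + hdist g h)" for x
      using hdist_upper[OF that(1,2), of x] hdist_upper[OF that(2,3), of x] by linarith
  qed
qed

lemma hdist_kuratowski:
  assumes "f \<in> tight"
  shows "hdist f (d u) = f u"
proof (rule antisym)
  show "hdist f (d u) \<le> f u"
    using tight_lipschitz[OF assms] by (intro hdist_least[OF assms kuratowski_tight]) (metis add.commute d_commute)
  show "f u \<le> hdist f (d u)"
    using hdist_upper[OF assms kuratowski_tight, of u u] by simp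
qed

definition injective_hull :: "('a \<Rightarrow> real) metric" where
  "injective_hull = metric (tight, hdist)"

lemma mspace_injective_hull [simp]: "mspace injective_hull = tight"
  and mdist_injective_hull [simp]: "mdist injective_hull = hdist"
  by (simp_all add: injective_hull_def)

theorem tight_injective_wrt: "injective_wrt TYPE('x) injective_hull"
  unfolding injective_wrt_def
proof (intro allI impI, elim conjE)
  fix X :: "'x metric" and A f
  assume A: "A \<subseteq> mspace X" and f: "one_lipschitz_map (submetric X A) injective_hull f"
  have fA: "f a \<in> tight" if "a \<in> A" for a
    using f A that by (auto simp: one_lipschitz_map_def)
  have f_lip: "hdist (f a) (f b) \<le> mdist X a b" if "a \<in> A" "b \<in> A" for a b
    using f A that by (auto simp: one_lipschitz_map_def)
  show "\<exists>F. one_lipschitz_map X injective_hull F \<and> (\<forall>a\<in>A. F a = f a)"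
  proof (cases "A = {}")
    case True
    then show ?thesis
      using kuratowski_tight[of undefined] by (intro exI[of _ "\<lambda>_. d undefined"]) (auto simp: one_lipschitz_map_def)
  next
    case False
    obtain \<Phi> where \<Phi>: "\<And>z. z \<in> mspace X \<Longrightarrow> \<Phi> z \<in> tight"
      "\<And>z w x. z \<in> mspace X \<Longrightarrow> w \<in> mspace X \<Longrightarrow> \<Phi> z x \<le> \<Phi> w x + mdist X z w"
      "\<And>z g. (z, g) \<in> (\<lambda>a. (a, f a)) ` A \<Longrightarrow> \<Phi> z = g"
    proof (rule tight_extension[of "mspace X" "mdist X" "(\<lambda>a. (a, f a)) ` A"])
      show "g x \<le> h x + mdist X z w"
        if "(z, g) \<in> (\<lambda>a. (a, f a)) ` A" "(w, h) \<in> (\<lambda>a. (a, f a)) ` A" for z g w h x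
        using that hdist_upper[OF fA fA, of z w x] f_lip[of z w] by auto
    qed (use A False fA in \<open>auto simp: mdist_commute intro: mdist_triangle\<close>)
    have "one_lipschitz_map X injective_hull \<Phi>"
      using \<Phi>(1,2) by (auto simp: one_lipschitz_map_def intro!: hdist_least)
    then show ?thesis using \<Phi>(3) by (intro exI[of _ \<Phi>]) auto
  qed
qed

section \<open>Extending a midpoint map to the injective hull\<close>

definition lip :: "(('a \<Rightarrow> real) \<Rightarrow> real) set" where
  "lip = {h. \<forall>f\<in>tight. \<forall>g\<in>tight. h f \<le> h g + hdist f g}"

lemma lipD: "h \<in> lip \<Longrightarrow> f \<in> tight \<Longrightarrow> g \<in> tight \<Longrightarrow> h f \<le> h g + hdist f g"
  by (simp add: lip_def)

lemma lip_uminus: "h \<in> lip \<Longrightarrow> (\<lambda>f. - h f) \<in> lip"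
  using tight.commute by (fastforce simp: lip_def)

lemma lip_hdist: "k \<in> tight \<Longrightarrow> (\<lambda>f. hdist f k) \<in> lip"
  using tight.triangle by (fastforce simp: lip_def)

lemma lip_add_const: "h \<in> lip \<Longrightarrow> (\<lambda>f. h f + c) \<in> lip"
  by (simp add: lip_def)

lemma lip_min: "h \<in> lip \<Longrightarrow> k \<in> lip \<Longrightarrow> (\<lambda>f. min (h f) (k f)) \<in> lip"
  by (fastforce simp: lip_def min_def)

text \<open>
  A triple \<open>(f, g, t)\<close> stands for the probability measure \<open>(1 - t) \<delta>\<^sub>f + t \<delta>\<^sub>g\<close>, and \<open>wdist\<close> is the
  Wasserstein distance in its dual form.
\<close>

definition triples :: "(('a \<Rightarrow> real) \<times> ('a \<Rightarrow> real) \<times> real) set" where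
  "triples = tight \<times> tight \<times> {0..1}"

definition expect :: "(('a \<Rightarrow> real) \<Rightarrow> real) \<Rightarrow> ('a \<Rightarrow> real) \<times> ('a \<Rightarrow> real) \<times> real \<Rightarrow> real" where
  "expect h = (\<lambda>(f, g, t). (1 - t) * h f + t * h g)"

definition wdist :: "('a \<Rightarrow> real) \<times> ('a \<Rightarrow> real) \<times> real \<Rightarrow> ('a \<Rightarrow> real) \<times> ('a \<Rightarrow> real) \<times> real \<Rightarrow> real" where
  "wdist z w = (SUP h\<in>lip. expect h z - expect h w)"

text \<open>Potentials are unbounded, but the bound relative to a fixed base point is uniform in
  \<open>h\<close>; this makes the supremum in \<open>wdist\<close> finite.\<close>

lemma expect_bound:
  assumes "z \<in> triples" "k \<in> tight"
  shows "\<exists>c. \<forall>h\<in>lip. \<bar>expect h z - h k\<bar> \<le> c"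
proof -
  obtain f g t where z: "z = (f, g, t)" "f \<in> tight" "g \<in> tight" "0 \<le> t" "t \<le> 1"
    using assms(1) by (auto simp: triples_def)
  have "\<bar>expect h z - h k\<bar> \<le> hdist f k + hdist g k" if "h \<in> lip" for h
  proof -
    have f: "\<bar>h f - h k\<bar> \<le> hdist f k" and g: "\<bar>h g - h k\<bar> \<le> hdist g k"
      using lipD[OF that z(2) assms(2)] lipD[OF that assms(2) z(2)]
        lipD[OF that z(3) assms(2)] lipD[OF that assms(2) z(3)] tight.commute[of k] by auto
    have "expect h z - h k = (1 - t) * (h f - h k) + t * (h g - h k)"
      by (simp add: expect_def z(1) algebra_simps)
    also have "\<bar>\<dots>\<bar> \<le> (1 - t) * \<bar>h f - h k\<bar> + t * \<bar>h g - h k\<bar>"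
      using z by (intro order_trans[OF abs_triangle_ineq]) (simp add: abs_mult)
    also have "\<dots> \<le> 1 * hdist f k + 1 * hdist g k"
      using z f g by (intro add_mono mult_mono) auto
    finally show ?thesis by simp
  qed
  then show ?thesis by blast
qed

lemma wdist_upper:
  assumes "z \<in> triples" "w \<in> triples" "h \<in> lip"
  shows "expect h z - expect h w \<le> wdist z w"
  unfolding wdist_def
proof (rule cSUP_upper[OF assms(3)])
  obtain b where b: "\<And>h. h \<in> lip \<Longrightarrow> \<bar>expect h z - h (d undefined)\<bar> \<le> b"
    using expect_bound[OF assms(1) kuratowski_tight] by blast
  obtain c where c: "\<And>h. h \<in> lip \<Longrightarrow> \<bar>expect h w - h (d undefined)\<bar> \<le> c"
    using expect_bound[OF assms(2) kuratowski_tight] by blast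
  show "bdd_above ((\<lambda>h. expect h z - expect h w) ` lip)"
    using b c by (intro bdd_aboveI[of _ "b + c"]) (fastforce simp: abs_le_iff)
qed

lemma wdist_least: "(\<And>h. h \<in> lip \<Longrightarrow> expect h z - expect h w \<le> c) \<Longrightarrow> wdist z w \<le> c"
  unfolding wdist_def using lip_hdist[OF kuratowski_tight] by (intro cSUP_least) auto

lemma wdist_commute:
  assumes "z \<in> triples" "w \<in> triples"
  shows "wdist z w = wdist w z"
proof -
  have "wdist z w \<le> wdist w z" if "z \<in> triples" "w \<in> triples" for z w
  proof (rule wdist_least)
    fix h assume "h \<in> lip"
    then show "expect h z - expect h w \<le> wdist w z"
      using wdist_upper[OF that(2,1) lip_uminus] by (fastforce simp: expect_def split_def algebra_simps)
  qed
  with assms show ?thesis by (intro antisym)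
qed

lemma wdist_triangle:
  assumes "z \<in> triples" "w \<in> triples" "v \<in> triples"
  shows "wdist z v \<le> wdist z w + wdist w v"
proof (rule wdist_least)
  show "expect h z - expect h v \<le> wdist z w + wdist w v" if "h \<in> lip" for h
    using wdist_upper[OF assms(1,2) that] wdist_upper[OF assms(2,3) that] by linarith
qed

lemma wdist_self: "z \<in> triples \<Longrightarrow> wdist z z = 0"
  using wdist_upper[of z z, OF _ _ lip_hdist[OF kuratowski_tight]]
  by (intro antisym wdist_least) auto

lemma wdist_nonneg: "z \<in> triples \<Longrightarrow> w \<in> triples \<Longrightarrow> 0 \<le> wdist z w"
  using wdist_triangle[of z w z] wdist_commute[of z w] wdist_self[of z] by simp

lemma wdist_conical:
  assumes "f \<in> tight" "g \<in> tight" "f' \<in> tight" "g' \<in> tight" "t \<in> {0..1}"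
  shows "wdist (f, g, t) (f', g', t) \<le> (1 - t) * hdist f f' + t * hdist g g'"
proof (rule wdist_least)
  fix h assume h: "h \<in> lip"
  have "(1 - t) * (h f - h f') \<le> (1 - t) * hdist f f'" "t * (h g - h g') \<le> t * hdist g g'"
    using lipD[OF h assms(1,3)] lipD[OF h assms(2,4)] assms(5) by (auto intro!: mult_left_mono)
  then show "expect h (f, g, t) - expect h (f', g', t) \<le> (1 - t) * hdist f f' + t * hdist g g'"
    by (simp add: expect_def algebra_simps)
qed

lemma wdist_segment:
  assumes "f \<in> tight" "g \<in> tight"
  shows "wdist (f, g, s) (f, g, t) \<le> \<bar>s - t\<bar> * hdist f g"
proof (rule wdist_least)
  fix h assume h: "h \<in> lip"
  have "expect h (f, g, s) - expect h (f, g, t) = (s - t) * (h g - h f)"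
    by (simp add: expect_def algebra_simps)
  also have "\<dots> \<le> \<bar>s - t\<bar> * \<bar>h g - h f\<bar>" by (metis abs_ge_self abs_mult)
  also have "\<dots> \<le> \<bar>s - t\<bar> * hdist f g"
    using lipD[OF h assms] lipD[OF h assms(2,1)] tight.commute[of f g] by (intro mult_left_mono) auto
  finally show "expect h (f, g, s) - expect h (f, g, t) \<le> \<bar>s - t\<bar> * hdist f g" .
qed

text \<open>Both triples encode the same measure; reversibility of the bicombing rests on
  this.\<close>

lemma wdist_reverse:
  assumes "(f, g, t) \<in> triples"
  shows "wdist (f, g, t) (g, f, 1 - t) = 0"
  using assms by (intro antisym wdist_nonneg wdist_least) (auto simp: expect_def triples_def)

lemma two_point_potential:
  assumes t: "f \<in> tight" "g \<in> tight" "f' \<in> tight" "g' \<in> tight"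
    and opt: "hdist f f' + hdist g g' \<le> hdist f g' + hdist g f'"
  shows "\<exists>h\<in>lip. hdist f f' + hdist g g' \<le> (h f + h g) - (h f' + h g')"
proof -
  \<comment> \<open>The shift is large enough for \<open>h f = hdist f f'\<close> and small enough
    for \<open>h g = hdist g g' + c\<close>. The upper bound holds for the first entry by
    \<open>opt\<close>, for the second by the triangle inequality.\<close>
  define c where "c = max (hdist f f' - hdist f g') (- hdist f' g')"
  define h where "h k = min (hdist k f') (hdist k g' + c)" for k
  have "h \<in> lip"
    unfolding h_def by (intro lip_min lip_add_const lip_hdist t)
  moreover have "hdist f f' + hdist g g' \<le> (h f + h g) - (h f' + h g')"
  proof -
    have "hdist f f' \<le> h f" by (auto simp: h_def c_def)
    moreover have "hdist g g' + c \<le> h g"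
      using opt tight.triangle[OF t(2,3,4)] tight.triangle[OF t(2,4,3)] tight.commute[of f' g']
      by (auto simp: h_def c_def)
    moreover have "h f' \<le> 0" "h g' \<le> c" using t by (auto simp: h_def)
    ultimately show ?thesis by linarith
  qed
  ultimately show ?thesis by blast
qed

text \<open>Between two pairs of equal masses, an optimal transport is one of the two matchings; a
  dual potential certifies the cheaper one.\<close>

lemma wdist_midpoint:
  assumes t: "f \<in> tight" "g \<in> tight" "f' \<in> tight" "g' \<in> tight"
  shows "min ((hdist f f' + hdist g g') / 2) ((hdist f g' + hdist g f') / 2)
    \<le> wdist (f, g, 1 / 2) (f', g', 1 / 2)"
proof -
  have "\<exists>h\<in>lip. min (hdist f f' + hdist g g') (hdist f g' + hdist g f') \<le> (h f + h g) - (h f' + h g')"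
  proof (cases "hdist f f' + hdist g g' \<le> hdist f g' + hdist g f'")
    case True
    with two_point_potential[OF t] show ?thesis by fastforce
  next
    case False
    then obtain h where "h \<in> lip" "hdist f g' + hdist g f' \<le> (h f + h g) - (h g' + h f')"
      using two_point_potential[OF t(1,2,4,3)] by auto
    then show ?thesis by (intro bexI[of _ h]) auto
  qed
  then obtain h where h: "h \<in> lip"
    "min (hdist f f' + hdist g g') (hdist f g' + hdist g f') \<le> (h f + h g) - (h f' + h g')" by blast
  have "(f, g, 1 / 2) \<in> triples" "(f', g', 1 / 2) \<in> triples" using t by (auto simp: triples_def)
  from wdist_upper[OF this h(1)] h(2) show ?thesis by (auto simp: expect_def min_def split: if_splits)
qed

text \<open>All mass must travel to \<open>k\<close>, and the distance to \<open>k\<close> is the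
  potential that certifies this cost.\<close>

lemma wdist_dirac:
  assumes "z \<in> triples" "w \<in> triples" "k \<in> tight" "\<And>h. expect h w = h k"
  shows "expect (\<lambda>f. hdist f k) z \<le> wdist z w"
  using wdist_upper[OF assms(1,2) lip_hdist[OF assms(3)]] assms(3,4) by simp

theorem bicombing_injective_hull:
  fixes m :: "'a \<Rightarrow> 'a \<Rightarrow> 'a"
  assumes m_self: "\<And>u. d (m u u) u = 0"
    and m_commute: "\<And>u v. d (m u v) (m v u) = 0"
    and m_conical: "\<And>u v u' v'. d (m u v) (m u' v') \<le> (d u u' + d v v') / 2"
  obtains \<sigma> where "bicombing injective_hull \<sigma>" "conical injective_hull \<sigma>" "reversible injective_hull \<sigma>"
    and "\<And>u v. \<sigma> (d u) (d v) (1 / 2) = d (m u v)"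
proof -
  text \<open>
    Extend the partial map that sends a Dirac measure to its base point and the measure
    \<open>(\<delta>\<^bsub>d u\<^esub> + \<delta>\<^bsub>d v\<^esub>) / 2\<close> to \<open>d (m u v)\<close>.  It is 1-Lipschitz because tight functions are convex along \<open>m\<close>.
  \<close>
  have convex: "f (m u v) \<le> (f u + f v) / 2" if "f \<in> tight" for f u v
  proof (rule tight_convex[OF that])
    show "d (m u v) y \<le> (d u y + d v y) / 2" for y
      using m_conical[of u v y y] d_triangle[of "m u v" y "m y y"] m_self[of y] by simp
  qed
  have m_conical': "d (m u v) (m u' v') \<le> (d u v' + d v u') / 2" for u v u' v'
    using m_conical[of u v v' u'] d_triangle[of "m u v" "m u' v'" "m v' u'"] m_commute[of v' u'] by simp
  \<comment> \<open>Testing against all \<open>h\<close> captures every encoding of a Dirac measure: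
    \<open>t = 0\<close>, \<open>t = 1\<close>, or equal points.\<close>
  define dirac where "dirac = {(z, f). z \<in> triples \<and> f \<in> tight \<and> (\<forall>h. expect h z = h f)}"
  define mids where "mids = (\<lambda>(u, v). ((d u, d v, 1 / 2 :: real), d (m u v))) ` UNIV"
  have diracD: "z \<in> triples" "f \<in> tight" "\<And>h. expect h z = h f" if "(z, f) \<in> dirac" for z f
    using that by (auto simp: dirac_def)
  have mid_triples: "(d u, d v, 1 / 2) \<in> triples" for u v
    using kuratowski_tight by (auto simp: triples_def)
  have dirac_mid: "hdist f (d (m u v)) \<le> wdist (d u, d v, 1 / 2) z" if "(z, f) \<in> dirac" for u v z f
  proof -
    note f = diracD[OF that]
    have "hdist f (d (m u v)) \<le> (f u + f v) / 2"
      using f(2) convex by (simp add: hdist_kuratowski)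
    also have "\<dots> = expect (\<lambda>k. hdist k f) (d u, d v, 1 / 2)"
      using f(2) by (simp add: expect_def tight.commute[of _ f] hdist_kuratowski)
    also have "\<dots> \<le> wdist (d u, d v, 1 / 2) z" by (rule wdist_dirac[OF mid_triples f])
    finally show ?thesis .
  qed
  \<comment> \<open>Conicality of \<open>m\<close> covers the straight matching, its commuted form
    the crossed one.\<close>
  have mid_mid: "hdist (d (m u v)) (d (m u' v')) \<le> wdist (d u, d v, 1 / 2) (d u', d v', 1 / 2)" for u v u' v'
    using wdist_midpoint[of "d u" "d v" "d u'" "d v'"] m_conical[of u v u' v'] m_conical'[of u v u' v']
    by (simp add: hdist_kuratowski kuratowski_tight min_def split: if_splits)
  have R_tight: "z \<in> triples" "f \<in> tight" if "(z, f) \<in> dirac \<union> mids" for z f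
    using that kuratowski_tight by (auto simp: dirac_def mids_def triples_def)
  have R_dist: "hdist f g \<le> wdist z w" if zf: "(z, f) \<in> dirac \<union> mids" and wg: "(w, g) \<in> dirac \<union> mids" for z f w g
  proof (cases "(z, f) \<in> dirac")
    case z: True
    show ?thesis
    proof (cases "(w, g) \<in> dirac")
      case True
      then show ?thesis
        using wdist_dirac[OF diracD(1)[OF z] diracD[OF True]] diracD(3)[OF z] by simp
    next
      case False
      then obtain u v where "w = (d u, d v, 1 / 2)" "g = d (m u v)" using wg by (auto simp: mids_def)
      then show ?thesis using dirac_mid[OF z] wdist_commute[OF diracD(1)[OF z] mid_triples] by simp
    qed
  next
    case False
    then obtain u v where z: "z = (d u, d v, 1 / 2)" "f = d (m u v)" using zf by (auto simp: mids_def)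
    show ?thesis
    proof (cases "(w, g) \<in> dirac")
      case True
      then show ?thesis using dirac_mid[OF True, of u v] tight.commute[of f g] z by simp
    next
      case False
      then obtain u' v' where "w = (d u', d v', 1 / 2)" "g = d (m u' v')" using wg by (auto simp: mids_def)
      then show ?thesis using z mid_mid by simp
    qed
  qed
  have R_sub: "dirac \<union> mids \<subseteq> triples \<times> tight"
    using kuratowski_tight by (auto simp: dirac_def mids_def triples_def)
  have R_nonempty: "dirac \<union> mids \<noteq> {}" by (auto simp: mids_def)
  obtain \<Phi> where \<Phi>_tight: "\<And>z. z \<in> triples \<Longrightarrow> \<Phi> z \<in> tight"
    and \<Phi>_lip: "\<And>z w x. z \<in> triples \<Longrightarrow> w \<in> triples \<Longrightarrow> \<Phi> z x \<le> \<Phi> w x + wdist z w"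
    and \<Phi>_R: "\<And>z f. (z, f) \<in> dirac \<union> mids \<Longrightarrow> \<Phi> z = f"
  proof (rule tight_extension[where Z = triples and D = wdist and R = "dirac \<union> mids",
        OF wdist_self wdist_nonneg wdist_commute wdist_triangle R_sub R_nonempty])
    show "f x \<le> g x + wdist z w" if "(z, f) \<in> dirac \<union> mids" "(w, g) \<in> dirac \<union> mids" for z f w g x
      using hdist_upper[OF R_tight(2)[OF that(1)] R_tight(2)[OF that(2)], of x] R_dist[OF that] by linarith
  qed (assumption+, rule that)
  have \<Phi>_dist: "hdist (\<Phi> z) (\<Phi> w) \<le> wdist z w" if "z \<in> triples" "w \<in> triples" for z w
    using that \<Phi>_lip by (intro hdist_least \<Phi>_tight)
  define \<sigma> where "\<sigma> f g t = \<Phi> (f, g, t)" for f g t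
  have triplesI: "(f, g, t) \<in> triples" if "f \<in> tight" "g \<in> tight" "t \<in> {0..1}" for f g t
    using that by (simp add: triples_def)
  have ends: "\<sigma> f g 0 = f" "\<sigma> f g 1 = g" if "f \<in> tight" "g \<in> tight" for f g
    unfolding \<sigma>_def using that by (auto intro!: \<Phi>_R simp: dirac_def triples_def expect_def)
  have segment: "hdist (\<sigma> f g s) (\<sigma> f g t) \<le> \<bar>s - t\<bar> * hdist f g"
    if "f \<in> tight" "g \<in> tight" "s \<in> {0..1}" "t \<in> {0..1}" for f g s t
    unfolding \<sigma>_def using that
    by (intro order_trans[OF \<Phi>_dist wdist_segment] triplesI)
  have \<sigma>_tight: "\<sigma> f g t \<in> tight" if "f \<in> tight" "g \<in> tight" "t \<in> {0..1}" for f g t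
    unfolding \<sigma>_def using that by (intro \<Phi>_tight triplesI)
  \<comment> \<open>The upper bounds for the three pieces add up to \<open>hdist f g\<close>, so the
    middle piece cannot be shorter.\<close>
  have geodesic: "hdist (\<sigma> f g s) (\<sigma> f g t) = \<bar>s - t\<bar> * hdist f g"
    if fg: "f \<in> tight" "g \<in> tight" and st: "s \<in> {0..1}" "t \<in> {0..1}" "s \<le> t" for f g s t
  proof (rule antisym[OF segment[OF fg st(1,2)]])
    have "hdist f g \<le> hdist f (\<sigma> f g s) + hdist (\<sigma> f g s) g"
         "hdist (\<sigma> f g s) g \<le> hdist (\<sigma> f g s) (\<sigma> f g t) + hdist (\<sigma> f g t) g"
      using fg st by (auto intro!: tight.triangle \<sigma>_tight)
    moreover have "hdist f (\<sigma> f g s) \<le> s * hdist f g" "hdist (\<sigma> f g t) g \<le> (1 - t) * hdist f g"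
      using segment[OF fg, of 0 s] segment[OF fg, of t 1] st by (auto simp: ends[OF fg])
    ultimately show "\<bar>s - t\<bar> * hdist f g \<le> hdist (\<sigma> f g s) (\<sigma> f g t)"
      using st(3) by (simp add: algebra_simps)
  qed
  show ?thesis
  proof (rule that)
    have "hdist (\<sigma> f g s) (\<sigma> f g t) = \<bar>s - t\<bar> * hdist f g"
      if "f \<in> tight" "g \<in> tight" "s \<in> {0..1}" "t \<in> {0..1}" for f g s t
      using geodesic[OF that] geodesic[OF that(1,2,4,3)]
        tight.commute[of "\<sigma> f g s" "\<sigma> f g t"]
      by (cases "s \<le> t") (auto simp: abs_minus_commute)
    then show "bicombing injective_hull \<sigma>"
      by (auto simp: bicombing_def is_geodesic_def ends \<sigma>_tight)
    show "conical injective_hull \<sigma>"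
      unfolding conical_def \<sigma>_def mspace_injective_hull mdist_injective_hull
      by (intro ballI order_trans[OF \<Phi>_dist wdist_conical] triplesI)
    show "reversible injective_hull \<sigma>"
      unfolding reversible_def mspace_injective_hull
    proof (intro ballI)
      fix f g t assume *: "f \<in> tight" "g \<in> tight" "t \<in> {0..1::real}"
      then have "hdist (\<sigma> f g t) (\<sigma> g f (1 - t)) \<le> 0"
        unfolding \<sigma>_def using wdist_reverse[OF triplesI[OF *]]
        by (intro order_trans[OF \<Phi>_dist]) (auto simp: triples_def)
      moreover have "\<sigma> f g t \<in> tight" "\<sigma> g f (1 - t) \<in> tight"
        using * by (auto intro!: \<sigma>_tight)
      ultimately show "\<sigma> f g t = \<sigma> g f (1 - t)"
        using tight.zero tight.nonneg by (metis antisym)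
    qed
    show "\<sigma> (d u) (d v) (1 / 2) = d (m u v)" for u v
      unfolding \<sigma>_def by (rule \<Phi>_R) (auto simp: mids_def)
  qed
qed

end

section \<open>The theorem\<close>

theorem theorem6p2:
  shows "\<exists>(Y :: point metric) \<sigma>.
           injective_metric_space Y \<and>
           bicombing Y \<sigma> \<and> conical Y \<sigma> \<and> reversible Y \<sigma> \<and>
           (\<exists>A. finite A \<and> A \<subseteq> mspace Y \<and>
                \<not> compactin (mtopology_of Y) (closed_convex_hull Y \<sigma> A))"
proof -
  \<comment> \<open>Trees are coded in \<open>nat \<Rightarrow> real\<close> so that tight functions
    have type \<open>point\<close>. Every sequence decodes to some tree, and \<open>d\<close> sees
    only that tree.\<close>
  define enc :: "trm \<Rightarrow> nat \<Rightarrow> real" where "enc t = (\<lambda>_. real (to_nat t))" for t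
  define dec :: "(nat \<Rightarrow> real) \<Rightarrow> trm" where "dec x = from_nat (nat \<lfloor>x 0\<rfloor>)" for x
  have dec_enc [simp]: "dec (enc t) = t" for t
    by (simp add: dec_def enc_def)
  define d where "d x y = tdist (dec x) (dec y)" for x y
  interpret pseudometric d
    by standard (auto simp: d_def intro: tdist_commute tdist_triangle)
  define m where "m x y = enc (Mid (dec x) (dec y))" for x y
  obtain \<sigma> where \<sigma>: "bicombing injective_hull \<sigma>" "conical injective_hull \<sigma>" "reversible injective_hull \<sigma>"
    and mid: "\<And>x y. \<sigma> (d x) (d y) (1 / 2) = d (m x y)"
  proof (rule bicombing_injective_hull[of m])
    show "d (m x x) x = 0" for x
      using tdist_halves_left[of "Mid (dec x) (dec x)" "dec x" "dec x" "dec x"]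
        tdist_nonneg[of "Mid (dec x) (dec x)" "dec x"]
      by (simp add: d_def m_def halves_def)
    show "d (m x y) (m y x) = 0" for x y
      using tdist_halves[of "Mid (dec x) (dec y)" "dec x" "dec y" "Mid (dec y) (dec x)" "dec x" "dec y"]
        tdist_nonneg[of "Mid (dec x) (dec y)" "Mid (dec y) (dec x)"]
      by (simp add: d_def m_def halves_def)
    show "d (m x y) (m x' y') \<le> (d x x' + d y y') / 2" for x y x' y'
      unfolding d_def m_def dec_enc by (rule tdist_halves) (auto simp: halves_def)
  qed (rule that)
  define A where "A = range (\<lambda>i. d (enc (Leaf i)))"
  \<comment> \<open>Induction on the tree: each \<open>Mid\<close> is reached at time
    \<open>1 / 2\<close> between its subtrees.\<close>
  have "d x \<in> C" if C: "bicombing_convex injective_hull \<sigma> C" "A \<subseteq> C" for C x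
  proof (induction "dec x" arbitrary: x)
    case (Leaf i)
    then have "d x = d (enc (Leaf i))" by (simp add: d_def fun_eq_iff)
    then show ?case using C(2) by (auto simp: A_def)
  next
    case (Mid s t)
    have "d x = d (m (enc s) (enc t))" by (simp add: d_def m_def fun_eq_iff Mid(3)[symmetric])
    moreover have "d (enc s) \<in> C" "d (enc t) \<in> C" using Mid(1,2) by simp_all
    then have "\<sigma> (d (enc s)) (d (enc t)) (1 / 2) \<in> C"
      using C(1) unfolding bicombing_convex_def image_subset_iff by auto
    ultimately show ?case by (simp add: mid)
  qed
  then have sub: "range d \<subseteq> closed_convex_hull injective_hull \<sigma> A"
    by (auto simp: closed_convex_hull_def)
  have "\<not> compactin (mtopology_of injective_hull) (closed_convex_hull injective_hull \<sigma> A)"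
  proof
    assume "compactin (mtopology_of injective_hull) (closed_convex_hull injective_hull \<sigma> A)"
    then have "tight.mtotally_bounded (range d)"
      using sub tight.mtotally_bounded_subset tight.compactin_imp_mtotally_bounded
      by (auto simp: mtopology_of_def)
    \<comment> \<open>The centres are themselves trees, so \<open>tdist_separated\<close> yields a
      tree outside all the balls.\<close>
    then obtain K where K: "finite K" "K \<subseteq> range d" "range d \<subseteq> (\<Union>f\<in>K. tight.mball f (1 / 4))"
      unfolding tight.mtotally_bounded_def by (meson zero_less_divide_1_iff zero_less_numeral)
    then obtain X where X: "finite X" "K = d ` X" by (meson finite_subset_image)
    obtain t where t: "\<And>x. x \<in> X \<Longrightarrow> 1 / 4 \<le> tdist (dec x) t"
      using tdist_separated[of "dec ` X"] X(1) by auto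
    obtain x where x: "x \<in> X" "d (enc t) \<in> tight.mball (d x) (1 / 4)" using K(3) X(2) by blast
    then have "d x (enc t) < 1 / 4" by (simp add: hdist_kuratowski kuratowski_tight)
    then show False using t[OF x(1)] by (simp add: d_def)
  qed
  moreover have "finite A" "A \<subseteq> mspace injective_hull"
    using kuratowski_tight by (auto simp: A_def)
  moreover have "injective_metric_space injective_hull"
    unfolding injective_metric_space_def by (rule tight_injective_wrt)
  ultimately show ?thesis using \<sigma>
    by (intro exI[of _ injective_hull] exI[of _ \<sigma>] conjI exI[of _ A])
qed

end
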